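(* Let $G$ be a finite group. If $|G|$ has at most two distinct prime divisors, then the coprime graph $\Gamma(G)$ is a divisor graph.
   Context: The coprime graph $\Gamma(G)$ of a finite group $G$ is the simple undirected graph with vertex set $G$ in which two distinct vertices $x,y$ are adjacent if and only if $\gcd(o(x),o(y))=1$, where $o(x)$ is the order of $x$. A simple undirected graph $\Gamma$ is a divisor graph if there is an injection $\alpha$ from $V(\Gamma)$ to the set of positive integers such that distinct $x,y\in V(\Gamma)$ are adjacent if and only if $\alpha(x)\mid\alpha(y)$ or $\alpha(y)\mid\alpha(x)$. *)

theory Defs
  imports "HOL-Computational_Algebra.Primes" "HOL-Algebra.Multiplicative_Group"
    "Graph_Theory.Pair_Digraph"
begin

text \<open>
  A simple undirected graph is a \<^locale>\<open>pair_graph\<close>: every edge is represented by its two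
  orientations in \<^const>\<open>parcs\<close>.
\<close>

definition coprime_graph :: "('a, 'b) monoid_scheme \<Rightarrow> 'a pair_pre_digraph" where
  "coprime_graph G =
    \<lparr> pverts = carrier G,
      parcs = {(x, y). x \<in> carrier G \<and> y \<in> carrier G \<and> x \<noteq> y \<and>
                       gcd (group.ord G x) (group.ord G y) = 1} \<rparr>"

lemma pair_graph_coprime_graph:
  assumes "finite (carrier G)"
  shows "pair_graph (coprime_graph G)"
proof
  show "finite (parcs (coprime_graph G))"
    by (rule finite_subset[of _ "carrier G \<times> carrier G"])
       (use assms in \<open>auto simp: coprime_graph_def\<close>)
  show "symmetric (with_proj (coprime_graph G))"
    by (auto simp: coprime_graph_def symmetric_def arcs_ends_def arc_to_ends_def gcd.commute
        intro!: symI)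
qed (use assms in \<open>auto simp: coprime_graph_def\<close>)

text \<open>This is meant for a graph that satisfies \<^const>\<open>pair_graph\<close>.\<close>

definition divisor_graph :: "'a pair_pre_digraph \<Rightarrow> bool" where
  "divisor_graph \<Gamma> \<longleftrightarrow>
    (\<exists>\<alpha> :: 'a \<Rightarrow> nat. inj_on \<alpha> (pverts \<Gamma>) \<and> (\<forall>x \<in> pverts \<Gamma>. \<alpha> x > 0) \<and>
      (\<forall>x \<in> pverts \<Gamma>. \<forall>y \<in> pverts \<Gamma>. x \<noteq> y \<longrightarrow>
        ((x, y) \<in> parcs \<Gamma> \<longleftrightarrow> \<alpha> x dvd \<alpha> y \<or> \<alpha> y dvd \<alpha> x)))"

end

theory Submission
  imports Defs
begin

text \<open>
  A finite graph is a divisor graph as soon as it is the comparability graph of a partial order on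
  its vertices: every finite partial order embeds into divisibility, because one can give each
  vertex a prime of its own and label a vertex with the product of the primes of its down-set
  (lemmas \<open>partial_order_embeds_in_dvd\<close> and \<open>divisor_graph_if_comparability_graph\<close>).

  It remains to orient the edges of the coprime graph transitively when the prime divisors of the
  order of the group are among \<open>p\<close> and \<open>q\<close>. The neutral element is adjacent to everything
  and is put at the bottom. Two nontrivial elements of coprime order have disjoint nonempty sets of
  primes contained in \<open>{p, q}\<close>, so one of them is a \<open>p\<close>-element and the other a
  \<open>q\<close>-element; the \<open>p\<close>-element is put below. Among nontrivial elements the upper end
  of an oriented edge is thus never the lower end of another, so a chain of
  two oriented edges starts at the neutral element, which lies below everything.
\<close>

lemma obtain_inj_primes:
  assumes "finite V"
  obtains \<pi> :: "'a \<Rightarrow> nat" where "inj_on \<pi> V" "\<And>x. x \<in> V \<Longrightarrow> prime (\<pi> x)"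
proof -
  obtain P :: "nat set" where P: "P \<subseteq> {p. prime p}" "finite P" "card P = card V"
    using infinite_arbitrarily_large[OF primes_infinite] by metis
  obtain \<pi> where "bij_betw \<pi> V P"
    using finite_same_card_bij[OF assms P(2)] P(3) by auto
  then show thesis
    using P(1) that[of \<pi>] by (auto simp: bij_betw_def)
qed

text \<open>
  With \<open>\<pi> x\<close> the prime of \<open>x\<close>, the squarefree label of \<open>x\<close> records the down-set
  of \<open>x\<close>, and divisibility of labels is inclusion of down-sets.
\<close>

lemma partial_order_embeds_in_dvd:
  assumes fin: "finite V" and po: "partial_order_on V R"
  obtains \<alpha> :: "'a \<Rightarrow> nat" where "inj_on \<alpha> V" "\<And>x. x \<in> V \<Longrightarrow> \<alpha> x > 0"
    "\<And>x y. x \<in> V \<Longrightarrow> y \<in> V \<Longrightarrow> \<alpha> x dvd \<alpha> y \<longleftrightarrow> (x, y) \<in> R"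
proof -
  from po have refl: "\<And>x. x \<in> V \<Longrightarrow> (x, x) \<in> R" and trans: "trans R" and antisym: "antisym R"
    by (auto simp: partial_order_on_def preorder_on_def refl_on_def)
  obtain \<pi> :: "'a \<Rightarrow> nat" where inj: "inj_on \<pi> V" and prime: "\<And>x. x \<in> V \<Longrightarrow> prime (\<pi> x)"
    using obtain_inj_primes[OF fin] by blast
  define D where "D x = {z \<in> V. (z, x) \<in> R}" for x
  define \<alpha> where "\<alpha> x = (\<Prod>z\<in>D x. \<pi> z)" for x
  have finD: "finite (D x)" for x
    using fin by (simp add: D_def)
  have dvd_iff: "\<alpha> x dvd \<alpha> y \<longleftrightarrow> (x, y) \<in> R" if x: "x \<in> V" and y: "y \<in> V" for x y
  proof
    assume "(x, y) \<in> R"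
    then have "D x \<subseteq> D y"
      using trans by (auto simp: D_def dest: transD)
    then show "\<alpha> x dvd \<alpha> y"
      unfolding \<alpha>_def by (intro prod_dvd_prod_subset finD)
  next
    assume dvd: "\<alpha> x dvd \<alpha> y"
    have "\<pi> x dvd \<alpha> x"
      unfolding \<alpha>_def using finD x refl by (intro dvd_prodI) (auto simp: D_def)
    with dvd have "\<pi> x dvd (\<Prod>z\<in>D y. \<pi> z)"
      unfolding \<alpha>_def by (rule dvd_trans[rotated])
    then obtain z where z: "z \<in> D y" "\<pi> x dvd \<pi> z"
      using prime_dvd_prod_iff[OF finD prime[OF x]] by blast
    then have "\<pi> x = \<pi> z"
      using prime x by (simp add: D_def primes_dvd_imp_eq)
    then have "x = z"
      using inj x z by (auto simp: D_def dest: inj_onD)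
    with z show "(x, y) \<in> R"
      by (simp add: D_def)
  qed
  show thesis
  proof (rule that)
    show "inj_on \<alpha> V"
      using dvd_iff antisym by (metis antisymD dvd_refl inj_onI)
    show "\<alpha> x > 0" for x
      unfolding \<alpha>_def by (intro prod_pos) (auto simp: D_def dest: prime prime_gt_0_nat)
  qed (rule dvd_iff)
qed

lemma divisor_graph_if_comparability_graph:
  assumes "finite (pverts \<Gamma>)" and "partial_order_on (pverts \<Gamma>) R"
    and "\<And>x y. x \<in> pverts \<Gamma> \<Longrightarrow> y \<in> pverts \<Gamma> \<Longrightarrow> x \<noteq> y \<Longrightarrow>
      (x, y) \<in> parcs \<Gamma> \<longleftrightarrow> (x, y) \<in> R \<or> (y, x) \<in> R"
  shows "divisor_graph \<Gamma>"
  using partial_order_embeds_in_dvd[OF assms(1,2)] assms(3)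
  unfolding divisor_graph_def by metis

lemma card_le_2_subset_pair:
  assumes "finite A" "card A \<le> 2"
  obtains p q where "A \<subseteq> {p, q}"
proof -
  consider "card A = 0" | "card A = 1" | "card A = 2"
    using assms(2) by linarith
  then show thesis
    using assms(1) that by cases (auto simp: card_1_singleton_iff card_2_iff)
qed

theorem theorem5p3:
  fixes G :: "('a, 'b) monoid_scheme"
  assumes "group G"
    and "finite (carrier G)"
    and "card (prime_factors (order G)) \<le> 2"
  shows "divisor_graph (coprime_graph G)"
proof -
  interpret group G by fact
  define S where "S x = prime_factors (ord x)" for x
  obtain p q where pq: "prime_factors (order G) \<subseteq> {p, q}"
    using card_le_2_subset_pair[OF _ assms(3)] by auto
  have S_sub: "S x \<subseteq> {p, q}" if "x \<in> carrier G" for x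
  proof -
    have "ord x dvd order G" "order G \<noteq> 0"
      using that assms(2) ord_dvd_group_order order_gt_0_iff_finite by auto
    then show ?thesis
      using pq dvd_prime_factors[of "order G" "ord x"] by (auto simp: S_def)
  qed
  have ord_pos: "ord x \<noteq> 0" if "x \<in> carrier G" for x
    using that assms(2) ord_ge_1 by fastforce
  have S_empty: "S x = {} \<longleftrightarrow> x = \<one>\<^bsub>G\<^esub>" if "x \<in> carrier G" for x
    using that ord_pos[OF that] ord_eq_1[OF that]
    by (auto simp: S_def prime_factorization_empty_iff)
  have coprime_iff: "gcd (ord x) (ord y) = 1 \<longleftrightarrow> S x \<inter> S y = {}"
    if "x \<in> carrier G" "y \<in> carrier G" for x y
  proof -
    have "gcd (ord x) (ord y) = 1 \<longleftrightarrow> prime_factors (gcd (ord x) (ord y)) = {}"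
      using ord_pos[OF that(1)] by (simp add: prime_factorization_empty_iff del: prime_factors_gcd)
    also have "prime_factors (gcd (ord x) (ord y)) = S x \<inter> S y"
      unfolding S_def by (rule prime_factors_gcd) (use ord_pos that in auto)
    finally show ?thesis .
  qed
  \<comment> \<open>The pair may degenerate to \<open>p = q\<close> when there are fewer than two prime divisors;
    then \<open>S x = {p}\<close> and \<open>S y = {q}\<close> must not make \<open>x\<close> and \<open>y\<close> comparable.\<close>
  define R where "R = {(x, y). x \<in> carrier G \<and> y \<in> carrier G \<and>
    (x = y \<or> x = \<one>\<^bsub>G\<^esub> \<or> S x = {p} \<and> S y = {q} \<and> p \<noteq> q)}"
  have "partial_order_on (carrier G) R"
    unfolding partial_order_on_def preorder_on_def
  proof (intro conjI)
    show "refl_on (carrier G) R"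
      by (auto simp: refl_on_def R_def)
    show "trans R"
      using S_empty by (auto simp: trans_def R_def)
    show "antisym R"
      using S_empty by (auto simp: antisym_def R_def)
  qed (auto simp: R_def)
  moreover have "gcd (ord x) (ord y) = 1 \<longleftrightarrow> (x, y) \<in> R \<or> (y, x) \<in> R"
    if "x \<in> carrier G" "y \<in> carrier G" "x \<noteq> y" for x y
  proof -
    have "S z = {} \<or> S z = {p} \<or> S z = {q} \<or> S z = {p, q}" if "z \<in> carrier G" for z
      using S_sub[OF that] by blast
    from this[OF that(1)] this[OF that(2)]
    have "S x \<inter> S y = {} \<longleftrightarrow>
      S x = {} \<or> S y = {} \<or> p \<noteq> q \<and> (S x = {p} \<and> S y = {q} \<or> S y = {p} \<and> S x = {q})"
      by (elim disjE) auto
    also have "\<dots> \<longleftrightarrow> (x, y) \<in> R \<or> (y, x) \<in> R"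
      using that by (auto simp: R_def S_empty)
    finally show ?thesis
      unfolding coprime_iff[OF that(1,2)] .
  qed
  ultimately show ?thesis
    using assms(2) by (intro divisor_graph_if_comparability_graph[of _ R])
      (auto simp: coprime_graph_def)
qed

end
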